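(* Let $\alpha=\log(1/h)$ and let $c>0$ with $\alpha c<1$. Let $(\delta_n)$ be a sequence of real numbers with $\lim_{n\to\infty}\delta_n(\log n)^{\alpha c}=0$, and define the random set of indices $\mathcal B_n=\{j\le n:\ \xi(S_j,\infty)\ge(1-\delta_n)\lambda_0\log n\}$. Then $$\lim_{n\to\infty}\max_{j\in\mathcal B_n}\max_{|z|\le c\log\log n}\left|\frac{\xi(S_j+z,\infty)}{m_z\lambda_0\log n}-1\right|=0\quad\text{a.s.}$$
   Context: Let $0<q<p<1$ with $p+q=1$, $h=q/p$, $\lambda_0=-1/\log(2q)$. Let $X_1,X_2,\dots$ be i.i.d. with $\mathbf P(X_1=1)=p$, $\mathbf P(X_1=-1)=q$, $S_0=0$, $S_n=X_1+\dots+X_n$. For $z\in\mathbb Z$ let $\xi(z,\infty)=\#\{k\ge1:S_k=z\}$ (finite a.s.). For $z\in\mathbb Z$ put $m_z=h^{|z|}/(2q)$ if $z\ne0$ and $m_0=1$. Indices $j$ range over nonnegative integers and $z$ over integers. *)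

theory Defs
  imports "HOL-Probability.Probability"
begin

text \<open>Walk: X 0, X 1, ... play the role of X_1, X_2, ...; so
  S_n = X_1 + ... + X_n is (\<Sum>k<n. X k).\<close>
definition walk :: "(nat \<Rightarrow> 'a \<Rightarrow> int) \<Rightarrow> nat \<Rightarrow> 'a \<Rightarrow> int" where
  "walk X n \<omega> = (\<Sum>k<n. X k \<omega>)"

text \<open>Total local time xi(z,infinity) = #{k >= 1 : S_k = z} (finite a.s.;
  card gives 0 on the null event where it is infinite).\<close>
definition loctime :: "(nat \<Rightarrow> 'a \<Rightarrow> int) \<Rightarrow> int \<Rightarrow> 'a \<Rightarrow> nat" where
  "loctime X z \<omega> = card {k::nat. k \<ge> 1 \<and> walk X k \<omega> = z}"

definition mz :: "real \<Rightarrow> real \<Rightarrow> int \<Rightarrow> real" where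
  "mz q h z = (if z = 0 then 1 else h ^ nat \<bar>z\<bar> / (2 * q))"

definition lambda0 :: "real \<Rightarrow> real" where
  "lambda0 q = - 1 / ln (2 * q)"

definition Bset :: "(nat \<Rightarrow> 'a \<Rightarrow> int) \<Rightarrow> real \<Rightarrow> (nat \<Rightarrow> real) \<Rightarrow> nat \<Rightarrow> 'a \<Rightarrow> nat set" where
  "Bset X q \<delta> n \<omega> = {j. j \<le> n \<and>
     real (loctime X (walk X j \<omega>) \<omega>) \<ge> (1 - \<delta> n) * lambda0 q * ln (real n)}"

end

theory Submission
  imports Defs "HOL-Real_Asymp.Real_Asymp"
begin

text \<open>
  For two sites \<open>x\<close> and \<open>x + z\<close> the exponential moment of the pair of local times is controlled by an explicit
  positive solution of the weighted harmonic equation. A Chernoff bound with the weight of \<open>x\<close> just below its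
  critical value shows that \<open>\<xi>(x) = r\<close> together with a relative deviation \<open>\<epsilon>\<close> of \<open>\<xi>(x + z)\<close> from \<open>m_z r\<close> has
  probability at most \<open>(2q)^r exp(- \<kappa> m_z r)\<close> up to polynomial factors. For \<open>|z| \<le> c log r + O(1)\<close> the
  exponent \<open>m_z r\<close> is of order at least \<open>r powr (1 - \<alpha> c)\<close>, so a union bound over
  \<open>|x| \<le> (2q)^(-r) exp(\<kappa>0 r powr (1 - \<alpha> c))\<close>, \<open>\<kappa>0\<close> small, is summable over the values \<open>r\<close> of the local time and
  Borel-Cantelli applies. Since \<open>\<delta> n * log n = o((log n) powr (1 - \<alpha> c))\<close>, every site of \<open>B_n\<close> lies in this
  window for \<open>r = \<xi>(x)\<close>. Indexing by \<open>r\<close> rather than by \<open>n\<close> avoids passing to a subsequence of \<open>n\<close>.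
\<close>

section \<open>Preliminaries: measurability, independence and Borel-Cantelli\<close>

lemma measurable_add_int [measurable]:
  fixes f g :: "'a \<Rightarrow> int"
  assumes [measurable]: "f \<in> measurable M (count_space UNIV)" "g \<in> measurable M (count_space UNIV)"
  shows "(\<lambda>x. f x + g x) \<in> measurable M (count_space UNIV)"
  by (rule measurable_compose_countable[where f = "\<lambda>i x. i + g x" and g = f]) measurable

lemma measurable_sum_int [measurable (raw)]:
  fixes f :: "'i \<Rightarrow> 'a \<Rightarrow> int"
  assumes "\<And>i. i \<in> I \<Longrightarrow> f i \<in> measurable M (count_space UNIV)"
  shows "(\<lambda>x. \<Sum>i\<in>I. f i x) \<in> measurable M (count_space UNIV)"
  using assms by (induction I rule: infinite_finite_induct) auto

lemma (in prob_space) indep_var_nn_integral_mult: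
  fixes F G :: "_ \<Rightarrow> ennreal"
  assumes "indep_var borel F borel G"
  shows "(\<integral>\<^sup>+\<omega>. F \<omega> * G \<omega> \<partial>M) = (\<integral>\<^sup>+\<omega>. F \<omega> \<partial>M) * (\<integral>\<^sup>+\<omega>. G \<omega> \<partial>M)"
proof -
  have "case_bool borel borel = (\<lambda>_. borel :: ennreal measure)"
    by (simp add: fun_eq_iff split: bool.split)
  then have "indep_vars (\<lambda>_. borel) (case_bool F G) UNIV"
    using assms by (simp add: indep_var_def)
  from indep_vars_nn_integral[OF _ this] show ?thesis
    by (simp add: UNIV_bool mult.commute)
qed

text \<open>Borel-Cantelli, with the bound demanded only from \<open>n = 1\<close> on: the
  probability estimates to which it is applied are for local times \<open>r\<close> of at least
  1.\<close>

lemma summable_imp_AE_eventually_notin: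
  assumes "finite_measure M" and "\<And>n. A n \<in> sets M"
    and le: "\<And>n. n \<ge> 1 \<Longrightarrow> measure M (A n) \<le> b n" and "summable b"
  shows "AE \<omega> in M. eventually (\<lambda>n. \<omega> \<notin> A n) sequentially"
proof -
  interpret finite_measure M by fact
  have "summable (\<lambda>n. measure M (A n))"
    by (rule summable_comparison_test'[OF \<open>summable b\<close>, of 1]) (use le in auto)
  with borel_cantelli_AE1[of A M] assms(2) show ?thesis
    by (auto simp: emeasure_eq_measure elim!: AE_mp eventually_mono)
qed

section \<open>The biased walk and a supermartingale bound for visit weights\<close>

locale biased_walk = prob_space +
  fixes X :: "nat \<Rightarrow> 'a \<Rightarrow> int" and p q :: real
  assumes indep: "indep_vars (\<lambda>_. count_space UNIV) X UNIV"
    and step_up: "\<And>i. prob {\<omega> \<in> space M. X i \<omega> = 1} = p"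
    and step_down: "\<And>i. prob {\<omega> \<in> space M. X i \<omega> = -1} = q"
    and q_pos: "0 < q" and q_less_p: "q < p" and p_plus_q: "p + q = 1"
begin

lemma X_measurable [measurable]: "X i \<in> measurable M (count_space UNIV)"
  using indep by (auto simp: indep_vars_def)

lemma walk_measurable [measurable]: "walk X k \<in> measurable M (count_space UNIV)"
  unfolding walk_def by measurable

lemma loctime_measurable [measurable]: "loctime X x \<in> measurable M (count_space UNIV)"
  unfolding loctime_def by measurable

lemma AE_step: "AE \<omega> in M. X i \<omega> = 1 \<or> X i \<omega> = -1"
proof -
  let ?A = "{\<omega> \<in> space M. X i \<omega> = 1}" and ?B = "{\<omega> \<in> space M. X i \<omega> = -1}"
  have "prob (?A \<union> ?B) = 1"
    by (subst finite_measure_Union) (auto simp: step_up step_down p_plus_q)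
  then have "AE \<omega> in M. \<omega> \<in> ?A \<union> ?B"
    by (intro prob_eq_1[THEN iffD1]) auto
  then show ?thesis by eventually_elim auto
qed

lemma AE_abs_walk_le: "AE \<omega> in M. \<forall>j. \<bar>walk X j \<omega>\<bar> \<le> int j"
proof -
  have "AE \<omega> in M. \<forall>i. X i \<omega> = 1 \<or> X i \<omega> = -1"
    by (simp add: AE_all_countable AE_step)
  then show ?thesis
  proof eventually_elim
    case (elim \<omega>)
    show ?case
    proof
      fix j show "\<bar>walk X j \<omega>\<bar> \<le> int j"
      proof (induction j)
        case (Suc j)
        with elim[rule_format, of j] show ?case by (auto simp: walk_def)
      qed (simp add: walk_def)
    qed
  qed
qed

text \<open>\<open>X N\<close> is independent of the first \<open>N\<close> steps. Writing the past
  as a functional \<open>F\<close> of the restricted path lets this independence replace conditional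
  expectations.\<close>

lemma nn_integral_past_times_step:
  fixes F :: "(nat \<Rightarrow> int) \<Rightarrow> ennreal"
  assumes F: "F \<in> borel_measurable (PiM {..<N} (\<lambda>_. count_space UNIV))"
    and e: "e = 1 \<or> e = -1"
  shows "(\<integral>\<^sup>+\<omega>. F (restrict (\<lambda>i. X i \<omega>) {..<N}) * indicator {e} (X N \<omega>) \<partial>M)
    = (if e = 1 then p else q) * (\<integral>\<^sup>+\<omega>. F (restrict (\<lambda>i. X i \<omega>) {..<N}) \<partial>M)"
proof -
  let ?M' = "\<lambda>_::nat. count_space (UNIV :: int set)"
  define G where "G = (\<lambda>y::nat \<Rightarrow> int. indicator {e} (y N) :: ennreal)"
  have [measurable]: "G \<in> borel_measurable (PiM {N} ?M')" 
    unfolding G_def by (rule measurable_compose[OF measurable_component_singleton]) auto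
  have "indep_var borel (F \<circ> (\<lambda>\<omega>. restrict (\<lambda>i. X i \<omega>) {..<N})) borel (G \<circ> (\<lambda>\<omega>. restrict (\<lambda>i. X i \<omega>) {N}))"
    by (rule indep_var_compose[OF indep_var_restrict[OF indep] F]) auto
  from indep_var_nn_integral_mult[OF this]
  have "(\<integral>\<^sup>+\<omega>. F (restrict (\<lambda>i. X i \<omega>) {..<N}) * indicator {e} (X N \<omega>) \<partial>M)
    = (\<integral>\<^sup>+\<omega>. F (restrict (\<lambda>i. X i \<omega>) {..<N}) \<partial>M) * (\<integral>\<^sup>+\<omega>. indicator {e} (X N \<omega>) \<partial>M)"
    by (simp add: G_def o_def)
  also have "(\<integral>\<^sup>+\<omega>. indicator {e} (X N \<omega>) \<partial>M) = (\<integral>\<^sup>+\<omega>. indicator {\<omega> \<in> space M. X N \<omega> = e} \<omega> \<partial>M)"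
    by (intro nn_integral_cong) (auto simp: indicator_def)
  also have "\<dots> = ennreal (prob {\<omega> \<in> space M. X N \<omega> = e})"
    by (subst nn_integral_indicator) (auto simp: emeasure_eq_measure)
  also have "\<dots> = ennreal (if e = 1 then p else q)"
    using e by (auto simp: step_up step_down)
  finally show ?thesis by (simp only: mult.commute)
qed

text \<open>\<open>f y\<close> is the weight of one visit to \<open>y\<close>. With \<open>W\<close>
  the one-step average of \<open>w\<close>, the expectation of \<open>Z N * W (walk X N)\<close>
  does not increase in \<open>N\<close>: the hypothesis \<open>super\<close> absorbs the newest
  factor of the product, and averaging over the last step restores \<open>W\<close>. The product
  starts at time 1, as the local time does, so the initial value is just \<open>W 0\<close>, at most
  \<open>C\<close>; dividing by the lower bound \<open>c0\<close> of \<open>W\<close> isolates the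
  product.\<close>

lemma nn_integral_prod_weights_le:
  fixes f w :: "int \<Rightarrow> real"
  assumes f_nonneg: "\<And>y. f y \<ge> 0"
    and super: "\<And>y. f y * (p * w (y + 1) + q * w (y - 1)) \<le> w y"
    and low: "\<And>y. c0 \<le> w y" and up: "\<And>y. w y \<le> C" and "c0 > 0"
  shows "(\<integral>\<^sup>+\<omega>. ennreal (\<Prod>k\<in>{1..N}. f (walk X k \<omega>)) \<partial>M) \<le> ennreal (C / c0)"
proof -
  let ?M' = "\<lambda>_::nat. count_space (UNIV :: int set)"
  define W where "W y = p * w (y + 1) + q * w (y - 1)" for y
  define Z where "Z N \<omega> = (\<Prod>k\<in>{1..N}. f (walk X k \<omega>))" for N \<omega>
  have w_nonneg: "w y \<ge> 0" for y using low[of y] \<open>c0 > 0\<close> by linarith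
  have pos: "p > 0" "q > 0" using q_pos q_less_p by auto
  have W_nonneg: "W y \<ge> 0" for y unfolding W_def using w_nonneg pos by simp
  have Z_nonneg: "Z N \<omega> \<ge> 0" for N \<omega> unfolding Z_def using f_nonneg by (simp add: prod_nonneg)
  have W_low: "c0 \<le> W y" for y
    using mult_left_mono[OF low[of "y+1"], of p] mult_left_mono[OF low[of "y-1"], of q] pos p_plus_q
    unfolding W_def by (metis add_mono_thms_linordered_semiring(1) distrib_right mult_1 less_imp_le)
  have W_up: "W y \<le> C" for y
    using mult_left_mono[OF up[of "y+1"], of p] mult_left_mono[OF up[of "y-1"], of q] pos p_plus_q
    unfolding W_def by (metis add_mono_thms_linordered_semiring(1) distrib_right mult_1 less_imp_le)
  have [measurable]: "Z N \<in> borel_measurable M" for N unfolding Z_def by measurable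
  have [measurable]: "(\<lambda>\<omega>. w (walk X N \<omega> + e)) \<in> borel_measurable M"
    "(\<lambda>\<omega>. w (walk X N \<omega> - e)) \<in> borel_measurable M"
    "(\<lambda>\<omega>. indicator A (X N \<omega>) :: ennreal) \<in> borel_measurable M" for N e A
    by (auto intro: measurable_compose[OF walk_measurable, where g = "\<lambda>s. w (s + e)"]
        measurable_compose[OF walk_measurable, where g = "\<lambda>s. w (s - e)"] measurable_compose[OF X_measurable])
  \<comment> \<open>On the event \<open>X N = e\<close> the value \<open>w (walk X (Suc N))\<close>
    equals \<open>w (walk X N + e)\<close>, which depends on the past only, so independence of the
    last step applies to each of the two cases.\<close>
  have shifted: "(\<integral>\<^sup>+\<omega>. ennreal (Z N \<omega> * w (walk X N \<omega> + e)) * indicator {e} (X N \<omega>) \<partial>M)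
      = (if e = 1 then p else q) * (\<integral>\<^sup>+\<omega>. ennreal (Z N \<omega> * w (walk X N \<omega> + e)) \<partial>M)"
    if e: "e = 1 \<or> e = -1" for e N
  proof -
    define F where "F y = ennreal ((\<Prod>k\<in>{1..N}. f (\<Sum>i<k. y i)) * w ((\<Sum>i<N. y i) + e))"
      for y :: "nat \<Rightarrow> int"
    have sums: "(\<lambda>y. \<Sum>i<k. y i) \<in> measurable (PiM {..<N} ?M') (count_space UNIV)" if "k \<le> N" for k
      using that by (intro measurable_sum_int measurable_component_singleton) auto
    have comp: "(\<lambda>y. g (\<Sum>i<k. y i)) \<in> borel_measurable (PiM {..<N} ?M')"
      if "k \<le> N" for g :: "int \<Rightarrow> real" and k
      using measurable_compose[OF sums[OF that], of g borel] by simp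
    have "F \<in> borel_measurable (PiM {..<N} ?M')"
      unfolding F_def
      by (intro measurable_compose[OF _ measurable_ennreal] borel_measurable_times
          borel_measurable_prod comp[of _ "\<lambda>s. w (s + e)"] comp[of _ f]) auto
    from nn_integral_past_times_step[OF this e]
    have "(\<integral>\<^sup>+\<omega>. F (restrict (\<lambda>i. X i \<omega>) {..<N}) * indicator {e} (X N \<omega>) \<partial>M)
      = (if e = 1 then p else q) * (\<integral>\<^sup>+\<omega>. F (restrict (\<lambda>i. X i \<omega>) {..<N}) \<partial>M)" .
    moreover have "F (restrict (\<lambda>i. X i \<omega>) {..<N}) = ennreal (Z N \<omega> * w (walk X N \<omega> + e))" for \<omega>
      unfolding F_def Z_def walk_def
      by (intro arg_cong[where f = ennreal] arg_cong2[where f = "(*)"] prod.cong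
          arg_cong[where f = f] arg_cong[where f = w] arg_cong2[where f = "(+)"] sum.cong) auto
    ultimately show ?thesis by simp
  qed
  have "(\<integral>\<^sup>+\<omega>. ennreal (Z N \<omega> * W (walk X N \<omega>)) \<partial>M) \<le> ennreal C" for N
  proof (induction N)
    case 0
    show ?case using W_up[of 0]
      by (simp add: Z_def walk_def emeasure_space_1 ennreal_leI)
  next
    case (Suc N)
    have "(\<integral>\<^sup>+\<omega>. ennreal (Z (Suc N) \<omega> * W (walk X (Suc N) \<omega>)) \<partial>M)
        \<le> (\<integral>\<^sup>+\<omega>. ennreal (Z N \<omega> * w (walk X (Suc N) \<omega>)) \<partial>M)"
    proof (intro nn_integral_mono ennreal_leI)
      fix \<omega>
      have "Z (Suc N) \<omega> * W (walk X (Suc N) \<omega>)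
          = Z N \<omega> * (f (walk X (Suc N) \<omega>) * W (walk X (Suc N) \<omega>))"
        by (simp add: Z_def)
      also have "\<dots> \<le> Z N \<omega> * w (walk X (Suc N) \<omega>)"
        using super[of "walk X (Suc N) \<omega>"] Z_nonneg by (intro mult_left_mono) (auto simp: W_def)
      finally show "Z (Suc N) \<omega> * W (walk X (Suc N) \<omega>) \<le> Z N \<omega> * w (walk X (Suc N) \<omega>)" .
    qed
    also have "\<dots> = (\<integral>\<^sup>+\<omega>. ennreal (Z N \<omega> * w (walk X N \<omega> + 1)) * indicator {1} (X N \<omega>)
        + ennreal (Z N \<omega> * w (walk X N \<omega> - 1)) * indicator {-1} (X N \<omega>) \<partial>M)"
      using AE_step[of N] by (intro nn_integral_cong_AE, eventually_elim) (auto simp: walk_def)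
    also have "\<dots> = p * (\<integral>\<^sup>+\<omega>. ennreal (Z N \<omega> * w (walk X N \<omega> + 1)) \<partial>M)
        + q * (\<integral>\<^sup>+\<omega>. ennreal (Z N \<omega> * w (walk X N \<omega> - 1)) \<partial>M)"
      by (subst nn_integral_add) (use shifted[of 1 N] shifted[of "-1" N] in simp_all)
    also have "\<dots> = (\<integral>\<^sup>+\<omega>. p * ennreal (Z N \<omega> * w (walk X N \<omega> + 1))
        + q * ennreal (Z N \<omega> * w (walk X N \<omega> - 1)) \<partial>M)"
      by (subst nn_integral_add) (auto simp: nn_integral_cmult)
    also have "\<dots> = (\<integral>\<^sup>+\<omega>. ennreal (Z N \<omega> * W (walk X N \<omega>)) \<partial>M)"
      using pos Z_nonneg w_nonneg
      by (intro nn_integral_cong)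
        (simp add: W_def ennreal_mult' [symmetric] ennreal_plus [symmetric] algebra_simps del: ennreal_plus)
    finally show ?case using Suc by (rule order_trans)
  qed
  have "ennreal c0 * (\<integral>\<^sup>+\<omega>. ennreal (Z N \<omega>) \<partial>M) = (\<integral>\<^sup>+\<omega>. ennreal (c0 * Z N \<omega>) \<partial>M)"
    using \<open>c0 > 0\<close> by (simp add: nn_integral_cmult ennreal_mult')
  also have "\<dots> \<le> (\<integral>\<^sup>+\<omega>. ennreal (Z N \<omega> * W (walk X N \<omega>)) \<partial>M)"
    using W_low Z_nonneg
    by (intro nn_integral_mono ennreal_leI) (metis mult.commute mult_right_mono)
  also have "\<dots> \<le> ennreal C" by fact
  finally have *: "ennreal c0 * (\<integral>\<^sup>+\<omega>. ennreal (Z N \<omega>) \<partial>M) \<le> ennreal C" .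
  have "(\<integral>\<^sup>+\<omega>. ennreal (Z N \<omega>) \<partial>M) = ennreal (1 / c0) * (ennreal c0 * (\<integral>\<^sup>+\<omega>. ennreal (Z N \<omega>) \<partial>M))"
    using \<open>c0 > 0\<close> by (simp add: mult.assoc[symmetric] ennreal_mult'[symmetric])
  also have "\<dots> \<le> ennreal (1 / c0) * ennreal C"
    using * by (rule mult_left_mono) simp
  also have "\<dots> = ennreal (C / c0)"
    using \<open>c0 > 0\<close> by (simp add: ennreal_mult'[symmetric])
  finally show ?thesis by (simp add: Z_def)
qed

end

section \<open>Joint exponential moments and Chernoff bounds for the local times of two
  sites\<close>

lemma prod_two_weights:
  fixes N :: nat
  assumes "a \<noteq> b"
  shows "(\<Prod>k\<in>{1..N}. if s k = a then u else if s k = b then v else 1 :: real)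
    = u ^ card {k\<in>{1..N}. s k = a} * v ^ card {k\<in>{1..N}. s k = b}"
proof -
  have "(\<Prod>k\<in>{1..N}. if s k = a then u else if s k = b then v else 1)
      = (\<Prod>k\<in>{1..N}. (if s k = a then u else 1) * (if s k = b then v else 1))"
    using assms by (intro prod.cong) auto
  then show ?thesis
    by (simp add: prod.distrib prod.inter_filter[symmetric])
qed

lemma eventually_initial_segment_eq:
  assumes "finite {k::nat. k \<ge> 1 \<and> P k}"
  shows "eventually (\<lambda>N. {k\<in>{1..N}. P k} = {k. k \<ge> 1 \<and> P k}) sequentially"
proof -
  obtain m where "\<forall>k\<in>{k. k \<ge> 1 \<and> P k}. k \<le> m" using assms finite_nat_set_iff_bounded_le by blast
  then have "{k\<in>{1..N}. P k} = {k. k \<ge> 1 \<and> P k}" if "N \<ge> m" for N using that by force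
  then show ?thesis by (rule eventually_mono[OF eventually_ge_at_top])
qed

context biased_walk
begin

lemma p_pos: "p > 0" and p_le_1: "p < 1"
  using q_pos q_less_p p_plus_q by auto

definition h :: real where "h = q / p"

lemma h_pos: "0 < h" and h_less_1: "h < 1"
  using q_pos q_less_p by (auto simp: h_def)

text \<open>Because \<open>p * h = q\<close> and \<open>q / h = p\<close>. This is the scale
  function of the walk: away from the weighted sites, solutions of the harmonic equation are affine
  in it.\<close>

lemma h_powi_harmonic: "p * h powi (k + 1) + q * h powi (k - 1) = h powi k"
proof -
  have "p * h = q" "q / h = p" using p_pos q_pos by (auto simp: h_def)
  moreover have "p * h powi (k + 1) + q * h powi (k - 1) = (p * h + q / h) * h powi k"
    using h_pos by (simp add: power_int_add power_int_diff distrib_right)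
  ultimately have "p * h powi (k + 1) + q * h powi (k - 1) = (q + p) * h powi k" by simp
  then show ?thesis using p_plus_q by simp
qed

lemma h_powi_bounds:
  assumes "k \<ge> 0" shows "0 < h powi k" "h powi k \<le> 1"
  using assms h_pos h_less_1 by (auto simp: power_int_def power_le_one)

text \<open>\<open>U\<close> and \<open>V\<close> parametrise the two visit weights so that the
  solution of the weighted harmonic equation is polynomial in them. The solution is 1 up to
  \<open>a\<close>, and its values elsewhere lie between 1, its value at \<open>b\<close>
  (hypotheses \<open>wd\<close>) and its limit at infinity (hypotheses \<open>wi\<close>). Hence
  these hypotheses bound it everywhere by \<open>c0\<close> and 2, and the supermartingale bound
  applies.\<close>

lemma nn_integral_two_weights_le:
  fixes U V c0 :: real and a b :: int
  defines "\<theta> \<equiv> h powi (b - a)"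
  assumes "a < b" and U: "(p - q) * U < 1" and V: "(p - q) * V < 1" and c0: "0 < c0" "c0 \<le> 1"
    and wd: "c0 \<le> 1 - U * (1 - \<theta>)" "1 - U * (1 - \<theta>) \<le> 2"
    and wi: "c0 \<le> (1 - U) * (1 - V) - U * V * \<theta>" "(1 - U) * (1 - V) - U * V * \<theta> \<le> 2"
  shows "(\<integral>\<^sup>+\<omega>. ennreal (\<Prod>k\<in>{1..N}. if walk X k \<omega> = a then 1 / (1 - (p - q) * U)
     else if walk X k \<omega> = b then 1 / (1 - (p - q) * V) else 1) \<partial>M) \<le> ennreal (2 / c0)"
proof -
  let ?wd = "1 - U * (1 - \<theta>)" and ?wi = "(1 - U) * (1 - V) - U * V * \<theta>"
  define f where "f y = (if y = a then 1 / (1 - (p - q) * U)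
     else if y = b then 1 / (1 - (p - q) * V) else 1)" for y
  define wl where "wl y = 1 - U * (1 - h powi (y - a))" for y
  define wr where "wr y = ?wi + (?wd - ?wi) * h powi (y - b)" for y
  \<comment> \<open>The bounded solution of \<open>w y = f y * (p * w (y + 1) + q * w (y - 1))\<close>; it is affine in
    \<open>h powi y\<close> between and to the right of the two sites, with value \<open>?wd\<close> at \<open>b\<close> and limit \<open>?wi\<close> at infinity.\<close>
  define w where "w y = (if y \<le> a then 1 else if y \<le> b then wl y else wr y)" for y
  have \<theta>: "0 < \<theta>" "\<theta> \<le> 1" using h_powi_bounds[of "b - a"] \<open>a < b\<close> by (auto simp: \<theta>_def)
  have q: "q = 1 - p" and ph: "p * h = q" using p_plus_q p_pos by (auto simp: h_def)
  have w_mid: "w y = wl y" if "a \<le> y" "y \<le> b" for y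
    using that by (auto simp: w_def wl_def)
  have w_left: "w y = 1" if "y \<le> a" for y using that by (simp add: w_def)
  have w_right: "w y = wr y" if "b \<le> y" for y
    using that \<open>a < b\<close> by (auto simp: w_def wl_def wr_def \<theta>_def)
  have harm_l: "p * wl (y + 1) + q * wl (y - 1) = wl y" for y
  proof -
    have "p * wl (y + 1) + q * wl (y - 1)
       = (p + q) * (1 - U) + U * (p * h powi ((y - a) + 1) + q * h powi ((y - a) - 1))"
      by (simp add: wl_def algebra_simps)
    then show ?thesis unfolding h_powi_harmonic p_plus_q by (simp add: wl_def algebra_simps)
  qed
  have harm_r: "p * wr (y + 1) + q * wr (y - 1) = wr y" for y
  proof -
    have "p * wr (y + 1) + q * wr (y - 1)
       = (p + q) * ?wi + (?wd - ?wi) * (p * h powi ((y - b) + 1) + q * h powi ((y - b) - 1))"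
      by (simp add: wr_def algebra_simps)
    then show ?thesis unfolding h_powi_harmonic p_plus_q by (simp add: wr_def)
  qed
  have at_a: "p * wl (a + 1) + q * 1 = 1 - (p - q) * U"
  proof -
    have "p * wl (a + 1) + q * 1 = (p + q) - U * (p - p * h)"
      by (simp add: wl_def algebra_simps)
    then show ?thesis by (simp add: ph p_plus_q mult.commute)
  qed
  \<comment> \<open>This matching condition at \<open>b\<close> is what determines the limit
    \<open>?wi\<close> in \<open>wr\<close>.\<close>
  have at_b: "p * wr (b + 1) + q * wl (b - 1) = (1 - (p - q) * V) * ?wd"
  proof -
    have "h powi (b - 1 - a) = \<theta> / h"
      using h_pos power_int_diff[of h "b - a" 1] by (simp add: \<theta>_def algebra_simps)
    then have "q * h powi (b - 1 - a) = p * \<theta>"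
      using p_pos q_pos by (simp add: h_def)
    then have "q * wl (b - 1) = q * (1 - U) + U * (p * \<theta>)"
      by (simp add: wl_def algebra_simps)
    moreover have "p * wr (b + 1) = p * ?wi + (?wd - ?wi) * (p * h)"
      by (simp add: wr_def algebra_simps)
    ultimately have "p * wr (b + 1) + q * wl (b - 1)
        = p * ?wi + (?wd - ?wi) * q + q * (1 - U) + U * (p * \<theta>)"
      by (simp only: ph add.assoc)
    also have "\<dots> = (1 - (p - q) * V) * ?wd" unfolding q by algebra
    finally show ?thesis .
  qed
  have super: "f y * (p * w (y + 1) + q * w (y - 1)) = w y" for y
  proof -
    consider "y < a" | "y = a" | "a < y" "y < b" | "y = b" | "b < y" by linarith
    then show ?thesis
    proof cases
      case 1 then show ?thesis using \<open>a < b\<close> p_plus_q by (simp add: f_def w_left)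
    next
      case 2
      then have "p * w (y + 1) + q * w (y - 1) = 1 - (p - q) * U"
        using \<open>a < b\<close> at_a by (simp add: w_mid w_left)
      then show ?thesis using 2 U by (simp add: f_def w_left)
    next
      case 3 then show ?thesis by (simp add: f_def w_mid harm_l)
    next
      case 4
      then have "p * w (y + 1) + q * w (y - 1) = (1 - (p - q) * V) * ?wd"
        using \<open>a < b\<close> at_b by (simp add: w_mid w_right)
      moreover have "w y = ?wd" using 4 \<open>a < b\<close> by (simp add: w_mid wl_def \<theta>_def)
      ultimately show ?thesis using 4 V \<open>a < b\<close> by (simp add: f_def)
    next
      case 5 then show ?thesis using \<open>a < b\<close> by (simp add: f_def w_right harm_r)
    qed
  qed
  \<comment> \<open>Between the sites \<open>w\<close> is affine in \<open>t\<close> with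
    \<open>t\<close> in \<open>[\<theta>, 1]\<close>, hence lies between its end values
    \<open>?wd\<close> and 1; the sign of \<open>U\<close> decides which is larger. To the right of
    \<open>b\<close> it is a convex combination of \<open>?wd\<close> and
    \<open>?wi\<close>.\<close>
  have bounds: "c0 \<le> w y \<and> w y \<le> 2" for y
  proof -
    consider "y \<le> a" | "a < y" "y \<le> b" | "b < y" by linarith
    then show ?thesis
    proof cases
      case 1 then show ?thesis using c0 by (simp add: w_left)
    next
      case 2
      define t where "t = h powi (y - a)"
      have "\<theta> = t * h powi (b - y)"
        using h_pos by (simp add: t_def \<theta>_def power_int_add[symmetric])
      moreover have "0 < t" "t \<le> 1" using h_powi_bounds[of "y - a"] 2 by (auto simp: t_def)
      ultimately have t: "\<theta> \<le> t" "t \<le> 1"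
        using h_powi_bounds[of "b - y"] 2 by (auto simp: mult_left_le)
      have w_t: "w y = 1 - U * (1 - t)" using 2 by (simp add: w_mid wl_def t_def)
      show ?thesis
      proof (cases "U \<ge> 0")
        case True
        then have "U * (1 - t) \<le> U * (1 - \<theta>)" "0 \<le> U * (1 - t)"
          using t by (auto intro!: mult_left_mono)
        then show ?thesis using w_t wd by linarith
      next
        case False
        then have "U * (1 - \<theta>) \<le> U * (1 - t)" "U * (1 - t) \<le> 0"
          using t by (auto intro!: mult_left_mono_neg simp: mult_le_0_iff)
        then show ?thesis using w_t wd c0 by linarith
      qed
    next
      case 3
      define t where "t = h powi (y - b)"
      have t: "0 \<le> t" "0 \<le> 1 - t" using h_powi_bounds[of "y - b"] 3 by (auto simp: t_def)
      have "w y = t * ?wd + (1 - t) * ?wi"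
        using 3 by (simp add: w_right wr_def t_def algebra_simps)
      moreover have "t * c0 + (1 - t) * c0 \<le> t * ?wd + (1 - t) * ?wi"
        "t * ?wd + (1 - t) * ?wi \<le> t * 2 + (1 - t) * 2"
        using t wd wi by (intro add_mono mult_left_mono; simp)+
      ultimately show ?thesis by (simp add: algebra_simps)
    qed
  qed
  show ?thesis
    using nn_integral_prod_weights_le[of f w c0 2 N] super bounds c0 U V
    unfolding f_def by auto
qed

text \<open>Transience from exponential moments: \<open>V = 0\<close> makes \<open>x + 1\<close> a
  dummy site of weight 1, and \<open>U = 1/2\<close> gives a weight \<open>u > 1\<close> at
  \<open>x\<close> with moments bounded by 4 uniformly in \<open>N\<close>. By monotone convergence
  infinitely many visits have probability zero.\<close>

lemma AE_finite_visits: "AE \<omega> in M. finite {k. k \<ge> 1 \<and> walk X k \<omega> = x}"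
proof -
  define u where "u = 1 / (1 - (p - q) * (1 / 2))"
  have "(p - q) * (1 / 2) < 1" "(p - q) * (1 / 2) > 0" using q_less_p p_le_1 q_pos by auto
  then have u: "u > 1" by (simp add: u_def)
  define Z where "Z N \<omega> = (\<Prod>k\<in>{1..N}. if walk X k \<omega> = x then u else if walk X k \<omega> = x + 1 then 1 else 1)"
    for N \<omega>
  have [measurable]: "Z N \<in> borel_measurable M" for N unfolding Z_def by measurable
  have Z: "Z N \<omega> = u ^ card {k\<in>{1..N}. walk X k \<omega> = x}" for N \<omega>
    unfolding Z_def by (subst prod_two_weights) auto
  have Z_le: "(\<integral>\<^sup>+\<omega>. ennreal (Z N \<omega>) \<partial>M) \<le> ennreal 4" for N
    using nn_integral_two_weights_le[of x "x + 1" "1/2" 0 "1/2" N] h_pos h_less_1 q_less_p p_le_1 q_pos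
    unfolding Z_def u_def by (simp only: mult_zero_right diff_zero div_by_1) simp
  have "incseq (\<lambda>N \<omega>. ennreal (Z N \<omega>))"
  proof (intro incseq_SucI le_funI ennreal_leI)
    fix N \<omega>
    have "Z (Suc N) \<omega> = Z N \<omega> * (if walk X (Suc N) \<omega> = x then u else 1)"
      by (simp add: Z_def)
    moreover have "Z N \<omega> \<ge> 0" using u by (simp add: Z)
    ultimately show "Z N \<omega> \<le> Z (Suc N) \<omega>" using u by (auto intro: mult_left_mono[of 1 u, simplified])
  qed
  then have "(\<integral>\<^sup>+\<omega>. (SUP N. ennreal (Z N \<omega>)) \<partial>M) = (SUP N. (\<integral>\<^sup>+\<omega>. ennreal (Z N \<omega>) \<partial>M))"
    by (intro nn_integral_monotone_convergence_SUP) auto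
  also have "\<dots> \<le> ennreal 4" using Z_le by (intro SUP_least)
  finally have "(\<integral>\<^sup>+\<omega>. (SUP N. ennreal (Z N \<omega>)) \<partial>M) \<noteq> \<infinity>" 
    by (metis ennreal_neq_top infinity_ennreal_def neq_top_trans)
  then have "AE \<omega> in M. (SUP N. ennreal (Z N \<omega>)) \<noteq> \<infinity>"
    by (intro nn_integral_PInf_AE) auto
  then show ?thesis
  proof eventually_elim
    case (elim \<omega>)
    show ?case
    proof (rule ccontr)
      assume inf: "infinite {k. k \<ge> 1 \<and> walk X k \<omega> = x}"
      obtain y where y: "y \<ge> 0" "(SUP N. ennreal (Z N \<omega>)) = ennreal y"
        using elim by (cases "SUP N. ennreal (Z N \<omega>)") auto
      obtain n where n: "y < u ^ n" using u real_arch_pow by blast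
      from infinite_arbitrarily_large[OF inf, of n] obtain B where
        B: "finite B" "card B = n" "B \<subseteq> {k. k \<ge> 1 \<and> walk X k \<omega> = x}" by blast
      obtain m where "\<forall>k\<in>B. k \<le> m" using B(1) finite_nat_set_iff_bounded_le by blast
      then have "B \<subseteq> {k\<in>{1..m}. walk X k \<omega> = x}" using B by auto
      then have "n \<le> card {k\<in>{1..m}. walk X k \<omega> = x}" using B(2) by (metis (no_types, lifting) card_mono finite_Collect_conjI finite_atLeastAtMost finite_subset mem_Collect_eq subsetI)
      then have "u ^ n \<le> Z m \<omega>" using u by (simp add: Z power_increasing)
      also have "ennreal (Z m \<omega>) \<le> ennreal y" by (metis SUP_upper UNIV_I y(2))
      then have "Z m \<omega> \<le> y" using y(1) by simp
      finally show False using n by simp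
    qed
  qed
qed

text \<open>Markov's inequality in the limit of infinite time. The truncated product is eventually
  constant in \<open>N\<close>, since both sites are visited finitely often almost surely. It need
  not be monotone when a weight is below 1, so Fatou's lemma is used.\<close>

lemma prob_loctime_event_le:
  assumes "a \<noteq> b" and uv: "u > 0" "v > 0" and [measurable]: "E \<in> events" and "\<beta> > 0" and "C \<ge> 0"
    and int: "\<And>N. (\<integral>\<^sup>+\<omega>. ennreal (\<Prod>k\<in>{1..N}. if walk X k \<omega> = a then u
     else if walk X k \<omega> = b then v else 1) \<partial>M) \<le> ennreal C"
    and E: "\<And>\<omega>. \<omega> \<in> E \<Longrightarrow> \<beta> \<le> u ^ loctime X a \<omega> * v ^ loctime X b \<omega>"
  shows "prob E \<le> C / \<beta>"
proof -
  define Z where "Z N \<omega> = (\<Prod>k\<in>{1..N}. if walk X k \<omega> = a then u else if walk X k \<omega> = b then v else 1)"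
    for N \<omega>
  have [measurable]: "Z N \<in> borel_measurable M" for N unfolding Z_def by measurable
  have Z: "Z N \<omega> = u ^ card {k\<in>{1..N}. walk X k \<omega> = a} * v ^ card {k\<in>{1..N}. walk X k \<omega> = b}" for N \<omega>
    unfolding Z_def using \<open>a \<noteq> b\<close> by (rule prod_two_weights)
  have "AE \<omega> in M. ennreal \<beta> * indicator E \<omega> \<le> liminf (\<lambda>N. ennreal (Z N \<omega>))"
    using AE_finite_visits[of a] AE_finite_visits[of b]
  proof eventually_elim
    case (elim \<omega>)
    show ?case
    proof (cases "\<omega> \<in> E")
      case True
      have "eventually (\<lambda>N. ennreal \<beta> \<le> ennreal (Z N \<omega>)) sequentially"
        using eventually_initial_segment_eq[OF elim(1)] eventually_initial_segment_eq[OF elim(2)]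
      proof eventually_elim
        case (elim N)
        then have "card {k\<in>{1..N}. walk X k \<omega> = a} = loctime X a \<omega>"
            "card {k\<in>{1..N}. walk X k \<omega> = b} = loctime X b \<omega>"
          by (auto simp: loctime_def intro!: arg_cong[where f = card])
        then show ?case using E[OF True] by (intro ennreal_leI) (simp add: Z)
      qed
      then show ?thesis using True by (simp add: Liminf_bounded)
    qed simp
  qed
  then have "(\<integral>\<^sup>+\<omega>. ennreal \<beta> * indicator E \<omega> \<partial>M) \<le> (\<integral>\<^sup>+\<omega>. liminf (\<lambda>N. ennreal (Z N \<omega>)) \<partial>M)"
    by (rule nn_integral_mono_AE)
  also have "\<dots> \<le> liminf (\<lambda>N. (\<integral>\<^sup>+\<omega>. ennreal (Z N \<omega>) \<partial>M))"
    by (intro nn_integral_liminf) auto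
  also have "\<dots> \<le> ennreal C"
    using int by (intro Liminf_le always_eventually allI) (simp_all add: Z_def)
  finally have "ennreal (\<beta> * prob E) \<le> ennreal C"
    using \<open>\<beta> > 0\<close> by (simp add: nn_integral_cmult_indicator emeasure_eq_measure ennreal_mult')
  then have "\<beta> * prob E \<le> C" using \<open>C \<ge> 0\<close> by simp
  then show ?thesis using \<open>\<beta> > 0\<close> by (simp add: field_simps)
qed


text \<open>The sign of \<open>V\<close> selects the tail of the local time at \<open>x + z\<close>:
  upper for \<open>V > 0\<close>, lower for \<open>V < 0\<close>, and no condition for
  \<open>V = 0\<close>. At \<open>U = 1\<close> the weight of \<open>x\<close> is
  \<open>1 / (2 * q)\<close>, the source of the factor \<open>(2 * q) ^ r\<close>; moving
  \<open>U\<close> to its near-critical value for the given \<open>V\<close> produces the term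
  \<open>\<theta> / (2 * q) * r / (1 - V)\<close>, which is compared with the threshold
  \<open>l\<close>.\<close>

lemma prob_loctime_pair_le:
  fixes V l :: real
  assumes "z \<noteq> 0" and "r \<ge> 1" and V: "\<bar>V\<bar> \<le> q" and "l \<ge> 0"
  defines "\<theta> \<equiv> h ^ nat \<bar>z\<bar>"
  shows "prob {\<omega> \<in> space M. loctime X x \<omega> = r \<and> V * (real (loctime X (x + z) \<omega>) - l) \<ge> 0}
    \<le> 8 * exp ((p - q) / q) * real r / \<theta> * (2 * q) ^ r
      * exp ((p - q) * V * (\<theta> / (2 * q) * real r / (1 - V) - l))"
proof -
  \<comment> \<open>Chosen so that the limit at infinity of the weight function is
    \<open>(1 - V) * (1 - U * (1 + t))\<close>.\<close>
  define t where "t = \<theta> * V / (1 - V)"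
  \<comment> \<open>For a given \<open>V\<close> the exponential moment is finite exactly for \<open>U < 1 / (1 + t)\<close>; staying a factor
    \<open>1 - 1 / r\<close> below this critical value costs only a factor of order \<open>r\<close>.\<close>
  define U where "U = (1 - 1 / real r) / (1 + t)"
  \<comment> \<open>Lies below both the limit at infinity, \<open>(1 - V) / r\<close>, and the value
    at the right-hand site, which is at least \<open>\<theta> / 4\<close> when \<open>x\<close> is
    the left site.\<close>
  define c0 where "c0 = \<theta> / (4 * real r)"
  define D where "D = p - q"
  have D: "0 < D" "D < 1" "D = 1 - 2 * q" using q_less_p q_pos p_plus_q by (auto simp: D_def)
  have q: "0 < q" "q < 1 / 2" using q_pos q_less_p p_plus_q by auto
  have r: "real r \<ge> 1" using \<open>r \<ge> 1\<close> by simp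
  have V2: "-1/2 < V" "V < 1/2" using V q by auto
  have \<theta>: "0 < \<theta>" "\<theta> < 1"
    using h_pos h_less_1 \<open>z \<noteq> 0\<close> by (auto simp: \<theta>_def power_less_one_iff)
  have \<theta>V: "\<bar>\<theta> * V\<bar> \<le> \<bar>V\<bar>" using \<theta> by (simp add: abs_mult mult_left_le_one_le)
  have t1: "1 + t = (1 - V + \<theta> * V) / (1 - V)" using V2 by (simp add: t_def field_simps)
  have den: "1 - V + \<theta> * V > 0" "1 - V + \<theta> * V \<le> 3/2"
  proof -
    have "1 - V + \<theta> * V = (1 - \<theta>) * (1 - V) + \<theta> * 1" by (simp add: algebra_simps)
    moreover have "(1 - \<theta>) * (1 - V) > 0" "(1 - \<theta>) * (1 - V) \<le> (1 - \<theta>) * (3/2)"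
      using \<theta> V2 mult_left_mono[of "1 - V" "3/2" "1 - \<theta>"] by auto
    ultimately show "1 - V + \<theta> * V > 0" "1 - V + \<theta> * V \<le> 3/2" using \<theta> by auto
  qed
  have tpos: "1 + t > 0" using den V2 unfolding t1 by simp
  have U_t: "U * (1 + t) = 1 - 1 / real r" using tpos by (simp add: U_def)
  have U_nonneg: "U \<ge> 0" using tpos r by (simp add: U_def)
  have U_le': "U \<le> 1 / (1 + t)" using tpos r by (simp add: U_def divide_right_mono)
  \<comment> \<open>Here \<open>\<bar>V\<bar> \<le> q\<close> enters: it keeps \<open>U\<close> at
    most \<open>1 + q\<close>, so \<open>D * U \<le> D + q = 1 - q < 1\<close> and the weight at
    \<open>x\<close> is finite and positive.\<close>
  have inv_t: "1 / (1 + t) \<le> 1 + q"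
  proof -
    have "1 - V \<le> (1 + q) * (1 - V + \<theta> * V)"
    proof (cases "V \<ge> 0")
      case True
      have "(1 + q) * (1 - V + \<theta> * V) - (1 - V) = q * (1 - V + \<theta> * V) + \<theta> * V"
        by (simp add: algebra_simps)
      moreover have "\<dots> \<ge> 0" using q den \<theta> True by simp
      ultimately show ?thesis by linarith
    next
      case False
      have "(1 + q) * (1 - V + \<theta> * V) - (1 - V) = (q + V) + (- V) * (q * (1 - \<theta>)) + (1 - \<theta>) * (- V)"
        by (simp add: algebra_simps)
      moreover have "(- V) * (q * (1 - \<theta>)) \<ge> 0" "(1 - \<theta>) * (- V) \<ge> 0" "q + V \<ge> 0"
        using q V \<theta> False by (auto simp: mult_le_0_iff)
      ultimately show ?thesis by linarith
    qed
    then show ?thesis unfolding t1 using den V2 by (simp add: field_simps)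
  qed
  have "D * U \<le> D * (1 + q)" using U_le' inv_t D by (intro mult_left_mono) auto
  also have "\<dots> \<le> D + q" using D q by (simp add: algebra_simps mult_left_le)
  also have "\<dots> < 1" using D q by simp
  finally have DU: "D * U < 1" .
  have DV: "D * V < 1" using D V2 mult_left_mono[of V "1/2" D] by linarith
  have c0: "0 < c0" "c0 \<le> 1" "c0 \<le> \<theta> / 4" "c0 \<le> 1 / (4 * real r)"
    using \<theta> r by (auto simp: c0_def field_simps intro: order_trans[of \<theta> 1])
  have wi: "(1 - U) * (1 - V) - U * V * \<theta> = (1 - V) / real r"
  proof -
    have "(1 - U) * (1 - V) - U * V * \<theta> = (1 - V) * (1 - U * (1 + t))"
      using V2 by (simp add: t_def field_simps)
    then show ?thesis by (simp add: U_t)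
  qed
  have wi_bounds: "c0 \<le> (1 - U) * (1 - V) - U * V * \<theta>" "(1 - U) * (1 - V) - U * V * \<theta> \<le> 2"
  proof -
    have "c0 \<le> (1/2) / real r" using c0(4) r by (simp add: field_simps)
    also have "\<dots> \<le> (1 - V) / real r" using V2 by (intro divide_right_mono) auto
    finally show "c0 \<le> (1 - U) * (1 - V) - U * V * \<theta>" unfolding wi .
    have "(1 - V) / real r \<le> (1 - V) / 1" using r V2 by (intro divide_left_mono) auto
    then show "(1 - U) * (1 - V) - U * V * \<theta> \<le> 2" unfolding wi using V2 by simp
  qed
  have wd_U: "c0 \<le> 1 - U * (1 - \<theta>)" "1 - U * (1 - \<theta>) \<le> 2"
  proof -
    have "1 - U * (1 - \<theta>) \<ge> 1 - 1 / (1 + t) * (1 - \<theta>)"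
      using mult_right_mono[OF U_le', of "1 - \<theta>"] \<theta> by simp
    also have "1 - 1 / (1 + t) * (1 - \<theta>) = \<theta> / (1 - V + \<theta> * V)"
      unfolding t1 using den V2 by (simp add: field_simps)
    finally have "1 - U * (1 - \<theta>) \<ge> \<theta> / (1 - V + \<theta> * V)" .
    moreover have "\<theta> / (1 - V + \<theta> * V) \<ge> \<theta> / 4"
      using den \<theta> by (intro divide_left_mono) auto
    ultimately show "c0 \<le> 1 - U * (1 - \<theta>)" using c0 by linarith
    show "1 - U * (1 - \<theta>) \<le> 2" using U_nonneg \<theta> mult_nonneg_nonneg[of U "1 - \<theta>"] by linarith
  qed
  have wd_V: "c0 \<le> 1 - V * (1 - \<theta>)" "1 - V * (1 - \<theta>) \<le> 2"
  proof -
    have "\<bar>V * (1 - \<theta>)\<bar> \<le> \<bar>V\<bar>" using \<theta> by (simp add: abs_mult mult_left_le)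
    then show "c0 \<le> 1 - V * (1 - \<theta>)" "1 - V * (1 - \<theta>) \<le> 2"
      using V2 c0 \<theta> by (auto simp: abs_le_iff)
  qed
  define u where "u = 1 / (1 - (p - q) * U)"
  define v where "v = 1 / (1 - (p - q) * V)"
  have u: "u > 0" and v: "v > 0" using DU DV by (auto simp: u_def v_def D_def)
  have int: "(\<integral>\<^sup>+\<omega>. ennreal (\<Prod>k\<in>{1..N}. if walk X k \<omega> = x then u
     else if walk X k \<omega> = x + z then v else 1) \<partial>M) \<le> ennreal (2 / c0)" for N
  \<comment> \<open>For negative \<open>z\<close> the left site is \<open>x + z\<close>, so
    \<open>U\<close> and \<open>V\<close> exchange roles. The limit at infinity is symmetric in
    them; the value at the right site is not, hence the separate bounds \<open>wd_U\<close> and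
    \<open>wd_V\<close>.\<close>
  proof (cases "z > 0")
    case True
    then have "h powi (x + z - x) = \<theta>" by (simp add: \<theta>_def power_int_def)
    note le = nn_integral_two_weights_le[of x "x + z" U V c0 N, unfolded this]
    show ?thesis unfolding u_def v_def
      by (rule le[OF _ DU[unfolded D_def] DV[unfolded D_def] c0(1,2) wd_U wi_bounds]) (use True in simp)
  next
    case False
    then have "h powi (x - (x + z)) = \<theta>" by (simp add: \<theta>_def power_int_def)
    note le = nn_integral_two_weights_le[of "x + z" x V U c0 N, unfolded this]
    have wi': "c0 \<le> (1 - V) * (1 - U) - V * U * \<theta>" "(1 - V) * (1 - U) - V * U * \<theta> \<le> 2"
      using wi_bounds by (simp_all add: ac_simps)
    have swap: "(\<Prod>k\<in>{1..N}. if walk X k \<omega> = x then u else if walk X k \<omega> = x + z then v else 1)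
      = (\<Prod>k\<in>{1..N}. if walk X k \<omega> = x + z then v else if walk X k \<omega> = x then u else 1)" for \<omega>
      using \<open>z \<noteq> 0\<close> by (intro prod.cong) auto
    show ?thesis unfolding swap unfolding u_def v_def
      by (rule le[OF _ DV[unfolded D_def] DU[unfolded D_def] c0(1,2) wd_V wi'])
        (use False \<open>z \<noteq> 0\<close> in simp)
  qed
  define \<beta> where "\<beta> = u ^ r * exp (l * ln v)"
  have "\<beta> > 0" using u by (simp add: \<beta>_def)
  have "prob {\<omega> \<in> space M. loctime X x \<omega> = r \<and> V * (real (loctime X (x + z) \<omega>) - l) \<ge> 0}
      \<le> (2 / c0) / \<beta>"
  proof (rule prob_loctime_event_le[OF _ u v _ \<open>\<beta> > 0\<close> _ int])
    show "x \<noteq> x + z" using \<open>z \<noteq> 0\<close> by simp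
    show "{\<omega> \<in> space M. loctime X x \<omega> = r \<and> V * (real (loctime X (x + z) \<omega>) - l) \<ge> 0} \<in> events"
      by measurable
    show "0 \<le> 2 / c0" using c0 by simp
    fix \<omega> assume "\<omega> \<in> {\<omega> \<in> space M. loctime X x \<omega> = r \<and> V * (real (loctime X (x + z) \<omega>) - l) \<ge> 0}"
    then have *: "loctime X x \<omega> = r" "V * (real (loctime X (x + z) \<omega>) - l) \<ge> 0" by auto
    \<comment> \<open>\<open>ln v\<close> has the sign of \<open>V\<close>, so the event says that
      \<open>v\<close> to the local time is at least \<open>v\<close> to the real power
      \<open>l\<close>, in either tail.\<close>
    have "ln v * (real (loctime X (x + z) \<omega>) - l) \<ge> 0"
    proof -
      have "ln v = - ln (1 - D * V)" using DV by (simp add: v_def D_def ln_div)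
      moreover have "V > 0 \<Longrightarrow> ln (1 - D * V) \<le> 0" using DV D by (intro ln_le_zero_iff[THEN iffD2]) auto
      moreover have "V < 0 \<Longrightarrow> ln (1 - D * V) \<ge> 0" using D by (intro ln_ge_zero) (auto simp: mult_le_0_iff)
      ultimately show ?thesis using *(2)
        by (cases "V = 0"; cases "V > 0") (auto simp: zero_le_mult_iff mult_le_0_iff)
    qed
    then have "exp (l * ln v) \<le> exp (real (loctime X (x + z) \<omega>) * ln v)"
      by (simp add: algebra_simps)
    also have "\<dots> = v ^ loctime X (x + z) \<omega>" using v by (simp add: exp_of_nat_mult)
    finally show "\<beta> \<le> u ^ loctime X x \<omega> * v ^ loctime X (x + z) \<omega>"
      using u *(1) by (simp add: \<beta>_def)
  qed
  also have "(2 / c0) / \<beta> = 8 * real r / \<theta> * ((1 - D * U) ^ r * exp (l * ln (1 - D * V)))"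
    using DU DV \<theta> r unfolding \<beta>_def c0_def u_def v_def D_def[symmetric]
    by (simp add: ln_div exp_minus power_one_over field_simps)
  also have "\<dots> \<le> 8 * real r / \<theta> * (((2 * q) ^ r * exp (D * V * (\<theta> / (2 * q) * real r / (1 - V)) + D / q))
      * exp (l * - (D * V)))"
  proof (intro mult_left_mono mult_mono)
    \<comment> \<open>Linearising \<open>1 / (1 + t)\<close> bounds \<open>1 - D * U\<close> by
      \<open>2 * q\<close> times one plus a small correction. After the \<open>r\<close>-th power
      the part \<open>D * t / (2 * q)\<close> gives the main exponent, while the loss
      \<open>1 / r\<close> in \<open>U\<close> costs only the constant
      \<open>exp (D / q)\<close>.\<close>
    have "1 - t \<le> 1 / (1 + t)"
      using tpos by (simp add: field_simps)
    then have "(1 - t) * (1 - 1 / real r) \<le> U"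
      using r mult_right_mono[of "1 - t" "1 / (1 + t)" "1 - 1 / real r"] by (simp add: U_def)
    then have "1 - D * U \<le> 1 - D * ((1 - t) * (1 - 1 / real r))"
      using D by (simp add: mult_left_mono)
    also have "\<dots> = 2 * q + D * t + D * (1 - t) / real r"
      unfolding D(3) using r by (simp add: field_simps)
    also have "\<dots> \<le> 2 * q + D * t + D * 2 / real r"
      using D tpos r by (intro add_left_mono divide_right_mono mult_left_mono) auto
    also have "\<dots> = 2 * q * (1 + (D * t / (2 * q) + D / (q * real r)))"
      using q r by (simp add: field_simps)
    also have "\<dots> \<le> 2 * q * exp (D * t / (2 * q) + D / (q * real r))"
      using q by (intro mult_left_mono exp_ge_add_one_self) auto
    finally have "(1 - D * U) ^ r \<le> (2 * q * exp (D * t / (2 * q) + D / (q * real r))) ^ r"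
      using DU by (intro power_mono) auto
    also have "\<dots> = (2 * q) ^ r * exp (real r * (D * t / (2 * q) + D / (q * real r)))"
      by (simp add: power_mult_distrib exp_of_nat_mult)
    also have "real r * (D * t / (2 * q) + D / (q * real r))
        = D * V * (\<theta> / (2 * q) * real r / (1 - V)) + D / q"
      using q r V2 by (simp add: t_def field_simps)
    finally show "(1 - D * U) ^ r
      \<le> (2 * q) ^ r * exp (D * V * (\<theta> / (2 * q) * real r / (1 - V)) + D / q)" .
    show "exp (l * ln (1 - D * V)) \<le> exp (l * - (D * V))"
      using \<open>l \<ge> 0\<close> DV ln_le_minus_one[of "1 - D * V"]
      by (intro exp_le_cancel_iff[THEN iffD2] mult_left_mono) auto
  qed (use \<theta> r q in auto)
  also have "\<dots> = 8 * exp (D / q) * real r / \<theta> * (2 * q) ^ r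
      * exp (D * V * (\<theta> / (2 * q) * real r / (1 - V) - l))"
    by (simp add: exp_add[symmetric] algebra_simps)
  finally show ?thesis by (simp add: D_def)
qed

end

section \<open>Summability, counting and union bounds over the values \<open>r\<close> of the local
  time\<close>

lemma summable_powr_times_stretched_exp:
  fixes a b s :: real
  assumes "a > 0" "b > 0"
  shows "summable (\<lambda>r::nat. real r powr s * exp (- a * real r powr b))"
proof (rule summable_comparison_test_bigo)
  show "summable (\<lambda>r::nat. norm (real r powr (-2)))"
    by (simp add: summable_real_powr_iff)
  show "(\<lambda>r::nat. real r powr s * exp (- a * real r powr b)) \<in> O(\<lambda>r. real r powr (-2))"
    using assms by real_asymp
qed

lemma card_int_ball_le:
  fixes R :: real
  assumes "R \<ge> 0"
  shows "finite {x::int. \<bar>x\<bar> \<le> R}" "real (card {x::int. \<bar>x\<bar> \<le> R}) \<le> 2 * R + 1"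
proof -
  have "{x::int. \<bar>x\<bar> \<le> R} = {- \<lfloor>R\<rfloor>..\<lfloor>R\<rfloor>}"
    by (auto simp: le_floor_iff abs_le_iff) linarith+
  then show "finite {x::int. \<bar>x\<bar> \<le> R}" "real (card {x::int. \<bar>x\<bar> \<le> R}) \<le> 2 * R + 1"
    using assms by (auto simp: of_nat_nat)
qed

lemma (in finite_measure) measure_UN_le_card:
  assumes "finite I" "\<And>i. i \<in> I \<Longrightarrow> A i \<in> sets M" "\<And>i. i \<in> I \<Longrightarrow> measure M (A i) \<le> B"
  shows "measure M (\<Union>i\<in>I. A i) \<le> real (card I) * B"
proof -
  have "measure M (\<Union>i\<in>I. A i) \<le> (\<Sum>i\<in>I. measure M (A i))"
    using assms by (intro finite_measure_subadditive_finite) auto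
  also have "\<dots> \<le> real (card I) * B" using assms(3) by (intro sum_bounded_above)
  finally show ?thesis .
qed

context biased_walk
begin

text \<open>The reciprocal of \<open>lambda0 q\<close>, the exponential rate in the bounds for a
  local time equal to \<open>r\<close>.\<close>

definition ell :: real where "ell = - ln (2 * q)"

lemma ell_pos: "ell > 0"
  using q_pos q_less_p p_plus_q by (simp add: ell_def)

lemma two_q_power: "(2 * q) ^ r = exp (- ell * real r)"
  using q_pos exp_of_nat_mult[of r "ln (2 * q)"] by (simp add: ell_def mult.commute)

text \<open>The pair bound with \<open>V = 0\<close> and \<open>l = 0\<close>, where the condition
  on the neighbour \<open>z = 1\<close> is vacuous.\<close>

lemma prob_loctime_eq_le:
  assumes "r \<ge> 1"
  shows "prob {\<omega> \<in> space M. loctime X x \<omega> = r} \<le> 8 * exp ((p - q) / q) / h * real r * exp (- ell * real r)"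
  using prob_loctime_pair_le[of 1 r 0 0 x] assms q_pos
  unfolding two_q_power by simp

text \<open>Of order \<open>exp (ell * r / (1 + \<epsilon>))\<close> sites, each with probability at
  most of order \<open>r * exp (- ell * r)\<close>, leave a summable bound. It serves to show that a
  site within distance \<open>n\<close> has local time below
  \<open>(1 + \<epsilon>) * lambda0 q * ln n\<close> once that local time is large.\<close>

lemma AE_eventually_loctime_neq:
  assumes "\<epsilon> > 0"
  shows "AE \<omega> in M. eventually (\<lambda>r. \<forall>x. real_of_int \<bar>x\<bar> \<le> exp (ell * real r / (1 + \<epsilon>)) \<longrightarrow> loctime X x \<omega> \<noteq> r) sequentially"
proof -
  define K where "K = 8 * exp ((p - q) / q) / h"
  define R where "R r = exp (ell * real r / (1 + \<epsilon>))" for r :: nat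
  define a where "a = ell * (\<epsilon> / (1 + \<epsilon>))"
  have "a > 0" "K > 0" using ell_pos assms h_pos by (auto simp: a_def K_def)
  define A where "A r = (\<Union>x\<in>{x::int. \<bar>x\<bar> \<le> R r}. {\<omega> \<in> space M. loctime X x \<omega> = r})" for r
  have "AE \<omega> in M. eventually (\<lambda>r. \<omega> \<notin> A r) sequentially"
  proof (rule summable_imp_AE_eventually_notin)
    show "finite_measure M" by unfold_locales
    show "A r \<in> events" for r
      unfolding A_def by (intro sets.countable_UN' countableI_type) auto
    show "summable (\<lambda>r. 3 * K * (real r powr 1 * exp (- a * real r powr 1)))"
      using \<open>a > 0\<close> by (intro summable_mult summable_powr_times_stretched_exp) auto
    fix r :: nat assume "r \<ge> 1"
    have R1: "R r \<ge> 1" using ell_pos assms by (simp add: R_def)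
    have "prob (A r) \<le> real (card {x::int. \<bar>x\<bar> \<le> R r}) * (K * real r * exp (- ell * real r))"
      unfolding A_def using R1 prob_loctime_eq_le[OF \<open>r \<ge> 1\<close>]
      by (intro measure_UN_le_card card_int_ball_le) (auto simp: K_def)
    also have "\<dots> \<le> (3 * R r) * (K * real r * exp (- ell * real r))"
      using card_int_ball_le(2)[of "R r"] R1 \<open>K > 0\<close> by (intro mult_right_mono) auto
    also have "\<dots> = 3 * K * (real r * exp (ell * real r / (1 + \<epsilon>) + - ell * real r))"
      unfolding exp_add by (simp add: R_def)
    also have "ell * real r / (1 + \<epsilon>) + - ell * real r = - a * real r"
      using assms by (simp add: a_def field_simps)
    finally show "prob (A r) \<le> 3 * K * (real r powr 1 * exp (- a * real r powr 1))"
      by simp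
  qed
  with AE_space show ?thesis
    by eventually_elim (auto simp: A_def R_def elim!: eventually_mono)
qed

text \<open>The Chernoff bound gains \<open>exp (- 2 * \<kappa> * b r)\<close> over
  \<open>exp (- ell * r)\<close>; the box of sites \<open>x\<close> spends half of this gain, and
  the rest beats all polynomial factors. \<open>K\<close> is there because \<open>log n\<close> will
  be known only up to a constant multiple of \<open>r\<close>.\<close>

lemma AE_eventually_neighbour_loctime_close:
  assumes \<epsilon>: "0 < \<epsilon>" "\<epsilon> \<le> 1" and "c > 0" "- ln h * c < 1" and "K > 0"
  shows "\<exists>\<kappa>>0. AE \<omega> in M. eventually (\<lambda>r. \<forall>x z.
    real_of_int \<bar>x\<bar> \<le> exp (ell * real r + \<kappa> * real r powr (1 + ln h * c)) \<longrightarrow> z \<noteq> 0 \<longrightarrow>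
    real_of_int \<bar>z\<bar> \<le> c * ln (K * real r) \<longrightarrow> loctime X x \<omega> = r \<longrightarrow>
    \<bar>real (loctime X (x + z) \<omega>) - h ^ nat \<bar>z\<bar> / (2 * q) * real r\<bar> < \<epsilon> * (h ^ nat \<bar>z\<bar> / (2 * q) * real r)) sequentially"
proof -
  define g where "g = - ln h * c"
  have g: "0 < g" "g < 1" using assms h_pos h_less_1 by (auto simp: g_def mult_neg_pos)
  define D where "D = p - q"
  have D: "0 < D" using q_less_p by (simp add: D_def)
  have q: "0 < q" "q < 1 / 2" using q_pos q_less_p p_plus_q by auto
  \<comment> \<open>The size of the Chernoff parameter \<open>V = s * \<sigma>\<close>: at most
    \<open>q\<close> as the pair bound requires, and at most \<open>\<epsilon> / 4\<close> so that
    replacing 1 by \<open>1 / (1 - V)\<close> uses up no more than half of the deviation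
    \<open>\<epsilon>\<close>.\<close>
  define \<sigma> where "\<sigma> = min q (\<epsilon> / 4)"
  have \<sigma>: "0 < \<sigma>" "\<sigma> \<le> q" "\<sigma> \<le> \<epsilon> / 4" using q \<epsilon> by (auto simp: \<sigma>_def)
  define \<kappa> where "\<kappa> = D * \<sigma> * \<epsilon> / 4 * (K powr (- g) / (2 * q))"
  have \<kappa>: "\<kappa> > 0" using D \<sigma> \<epsilon> q \<open>K > 0\<close> by (simp add: \<kappa>_def)
  define b where "b r = real r powr (1 - g)" for r :: nat
  define m where "m z = h ^ nat \<bar>z\<bar> / (2 * q)" for z :: int
  define C where "C = 8 * exp (D / q) * K powr g"
  have C: "C > 0" using \<open>K > 0\<close> by (simp add: C_def)
  define R where "R r = exp (ell * real r + \<kappa> * b r)" for r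
  \<comment> \<open>\<open>s = 1\<close> is the upper and \<open>s = -1\<close> the lower deviation
    event, both in the form of the pair bound.\<close>
  define E where "E s r x z = {\<omega> \<in> space M. loctime X x \<omega> = r \<and>
    s * \<sigma> * (real (loctime X (x + z) \<omega>) - (1 + s * \<epsilon>) * m z * real r) \<ge> 0}" for s r x z
  have E_meas: "E s r x z \<in> events" for s r x z unfolding E_def by measurable
  define I where "I r = {x::int. \<bar>x\<bar> \<le> R r} \<times> {z::int. z \<noteq> 0 \<and> \<bar>z\<bar> \<le> c * ln (K * real r)}" for r
  define A where "A r = (\<Union>(x,z)\<in>I r. E 1 r x z \<union> E (-1) r x z)" for r
  have E_le: "prob (E s r x z) \<le> C * real r ^ 2 * exp (- ell * real r - 2 * \<kappa> * b r)"
    if "r \<ge> 1" "z \<noteq> 0" "\<bar>z\<bar> \<le> c * ln (K * real r)" and s: "s = 1 \<or> s = -1" for s r x z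
  proof -
    define \<theta> where "\<theta> = h ^ nat \<bar>z\<bar>"
    have r: "real r \<ge> 1" using that by simp
    have "\<theta> > 0" using h_pos by (simp add: \<theta>_def)
    \<comment> \<open>The logarithmic range of \<open>z\<close> makes
      \<open>h ^ nat \<bar>z\<bar>\<close> at least \<open>(K * r) powr (- g)\<close>. This gives
      the polynomial bound on \<open>1 / \<theta>\<close> and the lower bound of order
      \<open>r powr (1 - g)\<close> on \<open>m z * r\<close>.\<close>
    have "- ln h * \<bar>z\<bar> \<le> - ln h * (c * ln (K * real r))"
      using that h_pos h_less_1 by (intro mult_left_mono) auto
    then have "exp (- (g * ln (K * real r))) \<le> exp (ln h * real_of_int \<bar>z\<bar>)"
      by (simp add: g_def algebra_simps)
    also have "exp (ln h * real_of_int \<bar>z\<bar>) = \<theta>"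
      using exp_of_nat_mult[of "nat \<bar>z\<bar>" "ln h"] h_pos by (simp add: \<theta>_def mult.commute)
    also have "exp (- (g * ln (K * real r))) = K powr (- g) * real r powr (- g)"
      using \<open>K > 0\<close> r 
      by (simp add: powr_def ln_mult exp_add[symmetric] algebra_simps)
    finally have \<theta>_ge: "K powr (- g) * real r powr (- g) \<le> \<theta>" .
    have "1 / \<theta> \<le> 1 / (K powr (- g) * real r powr (- g))"
      using \<theta>_ge \<open>\<theta> > 0\<close> \<open>K > 0\<close> r by (intro divide_left_mono) auto
    also have "\<dots> = K powr g * real r powr g" by (simp add: powr_minus field_simps)
    also have "\<dots> \<le> K powr g * real r powr 1"
      using g r by (intro mult_left_mono powr_mono) auto
    finally have inv_\<theta>: "1 / \<theta> \<le> K powr g * real r" using r by simp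
    have mr: "K powr (- g) / (2 * q) * b r \<le> m z * real r"
    proof -
      have "b r = real r powr (- g) * real r" using r powr_add[of "real r" "- g" 1] by (simp add: b_def)
      then have "K powr (- g) / (2 * q) * b r = (K powr (- g) * real r powr (- g)) * (real r / (2 * q))"
        by simp
      also have "\<dots> \<le> \<theta> * (real r / (2 * q))" using \<theta>_ge q by (intro mult_right_mono) auto
      finally show ?thesis by (simp add: m_def \<theta>_def)
    qed
    have mr_nonneg: "m z * real r \<ge> 0" using h_pos q by (simp add: m_def)
    \<comment> \<open>First order in \<open>\<sigma>\<close>: the gain is
      \<open>- \<sigma> * \<epsilon>\<close>, and the second-order error
      \<open>\<sigma> * \<sigma> / (1 - s * \<sigma>)\<close> is at most
      \<open>\<sigma> * \<epsilon> / 2\<close>.\<close>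
    have key: "s * \<sigma> * (1 / (1 - s * \<sigma>) - (1 + s * \<epsilon>)) \<le> - (\<sigma> * \<epsilon> / 2)"
    proof -
      have eq: "1 / (1 - s * \<sigma>) - (1 + s * \<epsilon>) = s * (\<sigma> / (1 - s * \<sigma>) - \<epsilon>)"
        using s \<sigma> q by (auto simp: field_simps)
      have "\<sigma> / (1 - s * \<sigma>) \<le> \<sigma> / (1 / 2)" using s \<sigma> q by (intro divide_left_mono) auto
      then have "\<sigma> / (1 - s * \<sigma>) - \<epsilon> \<le> - (\<epsilon> / 2)" using \<sigma> by simp
      then have "\<sigma> * (\<sigma> / (1 - s * \<sigma>) - \<epsilon>) \<le> \<sigma> * (- (\<epsilon> / 2))" using \<sigma> by (intro mult_left_mono) auto
      moreover have "s * \<sigma> * (s * y) = \<sigma> * y" for y using s by auto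
      ultimately show ?thesis unfolding eq by (simp only:)
    qed
    have "(1 + s * \<epsilon>) * m z * real r \<ge> 0" using s \<epsilon> h_pos q by (auto simp: m_def)
    then have "prob (E s r x z) \<le> 8 * exp (D / q) * real r / \<theta> * (2 * q) ^ r
      * exp (D * (s * \<sigma>) * (\<theta> / (2 * q) * real r / (1 - s * \<sigma>) - (1 + s * \<epsilon>) * m z * real r))"
      unfolding E_def D_def \<theta>_def using that \<sigma> by (intro prob_loctime_pair_le) auto
    also have "D * (s * \<sigma>) * (\<theta> / (2 * q) * real r / (1 - s * \<sigma>) - (1 + s * \<epsilon>) * m z * real r)
        = D * (m z * real r) * (s * \<sigma> * (1 / (1 - s * \<sigma>) - (1 + s * \<epsilon>)))"
      by (simp add: m_def \<theta>_def algebra_simps)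
    also have "8 * exp (D / q) * real r / \<theta> * (2 * q) ^ r
      * exp (D * (m z * real r) * (s * \<sigma> * (1 / (1 - s * \<sigma>) - (1 + s * \<epsilon>))))
      \<le> (8 * exp (D / q) * real r * (K powr g * real r)) * exp (- ell * real r) * exp (- 2 * \<kappa> * b r)"
    proof (intro mult_mono)
      show "8 * exp (D / q) * real r / \<theta> \<le> 8 * exp (D / q) * real r * (K powr g * real r)"
        using mult_left_mono[OF inv_\<theta>, of "8 * exp (D / q) * real r"] by simp
      have "D * (m z * real r) * (s * \<sigma> * (1 / (1 - s * \<sigma>) - (1 + s * \<epsilon>)))
          \<le> D * (m z * real r) * - (\<sigma> * \<epsilon> / 2)"
        using key D mr_nonneg by (intro mult_left_mono) auto
      also have "\<dots> = - (D * \<sigma> * \<epsilon> / 2) * (m z * real r)" by simp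
      also have "\<dots> \<le> - (D * \<sigma> * \<epsilon> / 2) * (K powr (- g) / (2 * q) * b r)"
        using mr D \<sigma> \<epsilon> by (intro mult_left_mono_neg) auto
      also have "\<dots> = - 2 * \<kappa> * b r" by (simp add: \<kappa>_def)
      finally show "exp (D * (m z * real r) * (s * \<sigma> * (1 / (1 - s * \<sigma>) - (1 + s * \<epsilon>)))) \<le> exp (- 2 * \<kappa> * b r)"
        by simp
      show "(2 * q) ^ r \<le> exp (- ell * real r)" by (simp only: two_q_power)
      show "0 \<le> (2 * q) ^ r" using q by simp
    qed (use \<open>\<theta> > 0\<close> in auto)
    also have "\<dots> = C * real r ^ 2 * exp (- ell * real r - 2 * \<kappa> * b r)"
      by (simp add: C_def power2_eq_square exp_diff exp_minus field_simps)
    finally show ?thesis .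
  qed
  have "AE \<omega> in M. eventually (\<lambda>r. \<omega> \<notin> A r) sequentially"
  proof (rule summable_imp_AE_eventually_notin)
    show "finite_measure M" by unfold_locales
    show "A r \<in> events" for r
      unfolding A_def using E_meas by (intro sets.countable_UN' countableI_type) auto
    show "summable (\<lambda>r. 6 * C * (2 * c * K + 1) * (real r powr 3 * exp (- \<kappa> * real r powr (1 - g))))"
      using \<kappa> g by (intro summable_mult summable_powr_times_stretched_exp) auto
    fix r :: nat assume "r \<ge> 1"
    then have r: "real r \<ge> 1" by simp
    let ?Z = "{z::int. z \<noteq> 0 \<and> \<bar>z\<bar> \<le> c * ln (K * real r)}" and ?X = "{x::int. \<bar>x\<bar> \<le> R r}"
    have R1: "R r \<ge> 1" using ell_pos \<kappa> by (simp add: R_def b_def)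
    have fX: "finite ?X" "real (card ?X) \<le> 3 * R r"
      using card_int_ball_le[of "R r"] R1 by auto
    have "K * real r > 0" using \<open>K > 0\<close> r by (intro mult_pos_pos) auto
    \<comment> \<open>A crude linear count of the \<open>z\<close> suffices, as it only adds a power
      of \<open>r\<close>.\<close>
    then have "ln (K * real r) \<le> K * real r" by (intro less_imp_le ln_less_self)
    then have sub: "?Z \<subseteq> {z::int. \<bar>z\<bar> \<le> c * (K * real r)}"
      using \<open>c > 0\<close> by (auto intro: order_trans mult_left_mono)
    have cKr: "c * (K * real r) \<ge> 0" using \<open>c > 0\<close> \<open>K > 0\<close> by simp
    have fZ: "finite ?Z" using finite_subset[OF sub card_int_ball_le(1)[OF cKr]] .
    have "real (card ?Z) \<le> 2 * (c * (K * real r)) + 1"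
      using card_mono[OF card_int_ball_le(1)[OF cKr] sub] card_int_ball_le(2)[OF cKr] by linarith
    also have "\<dots> \<le> (2 * c * K + 1) * real r" using r by (simp add: algebra_simps)
    finally have cZ: "real (card ?Z) \<le> (2 * c * K + 1) * real r" .
    let ?B = "C * real r ^ 2 * exp (- ell * real r - 2 * \<kappa> * b r)"
    have "prob (A r) \<le> real (card (I r)) * (2 * ?B)"
      unfolding A_def
    proof (intro measure_UN_le_card)
      show "finite (I r)" unfolding I_def using fX fZ by simp
      fix i assume "i \<in> I r"
      then obtain x z where i: "i = (x, z)" "z \<noteq> 0" "\<bar>z\<bar> \<le> c * ln (K * real r)" by (auto simp: I_def)
      have "prob (E 1 r x z \<union> E (-1) r x z) \<le> prob (E 1 r x z) + prob (E (-1) r x z)"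
        using E_meas by (intro measure_Un_le) auto
      also have "\<dots> \<le> ?B + ?B" using E_le[OF \<open>r \<ge> 1\<close> i(2,3)] by (intro add_mono) auto
      finally show "prob (case i of (x, z) \<Rightarrow> E 1 r x z \<union> E (-1) r x z) \<le> 2 * ?B" using i by simp
    qed (use E_meas in auto)
    also have "\<dots> \<le> ((3 * R r) * ((2 * c * K + 1) * real r)) * (2 * ?B)"
      unfolding I_def card_cartesian_product of_nat_mult
      using fX cZ R1 C by (intro mult_right_mono mult_mono) auto
    also have "\<dots> = 6 * C * (2 * c * K + 1) * (real r ^ 3 * exp (- \<kappa> * b r))"
    proof -
      have "R r * exp (- ell * real r - 2 * \<kappa> * b r) = exp (- \<kappa> * b r)"
        by (simp add: R_def exp_add[symmetric])
      then show ?thesis by (simp add: power2_eq_square power3_eq_cube)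
    qed
    finally show "prob (A r) \<le> 6 * C * (2 * c * K + 1) * (real r powr 3 * exp (- \<kappa> * real r powr (1 - g)))"
      using r by (simp add: b_def)
  qed
  with AE_space have "AE \<omega> in M. eventually (\<lambda>r. \<forall>x z. real_of_int \<bar>x\<bar> \<le> R r \<longrightarrow> z \<noteq> 0 \<longrightarrow>
    real_of_int \<bar>z\<bar> \<le> c * ln (K * real r) \<longrightarrow> loctime X x \<omega> = r \<longrightarrow>
    \<bar>real (loctime X (x + z) \<omega>) - m z * real r\<bar> < \<epsilon> * (m z * real r)) sequentially"
  proof eventually_elim
    case (elim \<omega>)
    show ?case using elim(2)
    proof eventually_elim
      case (elim r)
      show ?case
      proof (intro allI impI)
        fix x z assume *: "real_of_int \<bar>x\<bar> \<le> R r" "z \<noteq> 0" "real_of_int \<bar>z\<bar> \<le> c * ln (K * real r)" "loctime X x \<omega> = r"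
        then have "(x, z) \<in> I r" by (simp add: I_def)
        with elim have "\<omega> \<notin> E 1 r x z" "\<omega> \<notin> E (-1) r x z" by (auto simp: A_def)
        with *(4) \<open>\<omega> \<in> space M\<close>
        have "\<not> 0 \<le> 1 * \<sigma> * (real (loctime X (x + z) \<omega>) - (1 + 1 * \<epsilon>) * m z * real r)"
          "\<not> 0 \<le> -1 * \<sigma> * (real (loctime X (x + z) \<omega>) - (1 + -1 * \<epsilon>) * m z * real r)"
          unfolding E_def by blast+
        then have "real (loctime X (x + z) \<omega>) - (1 + \<epsilon>) * m z * real r < 0"
          "real (loctime X (x + z) \<omega>) - (1 - \<epsilon>) * m z * real r > 0"
          using \<sigma> by (simp_all add: zero_le_mult_iff mult_le_0_iff)
        then show "\<bar>real (loctime X (x + z) \<omega>) - m z * real r\<bar> < \<epsilon> * (m z * real r)"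
          by (simp add: abs_less_iff algebra_simps)
      qed
    qed
  qed
  with \<kappa> show ?thesis unfolding R_def b_def m_def g_def by auto
qed


section \<open>Passage from the local time \<open>r\<close> to the time \<open>n\<close>\<close>

text \<open>For \<open>j\<close> in \<open>Bset\<close> put \<open>x = walk X j\<close> and
  \<open>r = loctime X x\<close>. The ratio factors as \<open>a * \<rho>\<close>, where
  \<open>a\<close> compares the local time at \<open>x + z\<close> with \<open>m * r\<close> and
  \<open>\<rho> = ell * r / ln n\<close>. The definition of \<open>Bset\<close> bounds
  \<open>\<rho>\<close> from below, the absence of too large local times bounds it from above, and
  the neighbour estimate controls \<open>a\<close>.\<close>

lemma AE_eventually_loctime_ratio_close:
  fixes \<delta> :: "nat \<Rightarrow> real"
  assumes \<epsilon>: "0 < \<epsilon>" "\<epsilon> \<le> 1" and c: "c > 0" "- ln h * c < 1"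
    and \<delta>: "(\<lambda>n. \<delta> n * ln (real n) powr (- ln h * c)) \<longlonglongrightarrow> 0"
  shows "AE \<omega> in M. eventually (\<lambda>n. \<forall>j\<in>Bset X q \<delta> n \<omega>. \<forall>z. real_of_int \<bar>z\<bar> \<le> c * ln (ln (real n)) \<longrightarrow>
    \<bar>real (loctime X (walk X j \<omega> + z) \<omega>) / (mz q h z * lambda0 q * ln (real n)) - 1\<bar> \<le> 3 * \<epsilon>) sequentially"
proof -
  define g where "g = - ln h * c"
  have g: "0 < g" "g < 1" using c h_pos h_less_1 by (auto simp: g_def mult_neg_pos)
  have lambda0: "lambda0 q = 1 / ell" using ell_pos by (simp add: lambda0_def ell_def field_simps)
  obtain \<kappa> where \<kappa>: "\<kappa> > 0" and close: "AE \<omega> in M. eventually (\<lambda>r. \<forall>x z.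
    real_of_int \<bar>x\<bar> \<le> exp (ell * real r + \<kappa> * real r powr (1 - g)) \<longrightarrow> z \<noteq> 0 \<longrightarrow>
    real_of_int \<bar>z\<bar> \<le> c * ln (2 * ell * real r) \<longrightarrow> loctime X x \<omega> = r \<longrightarrow>
    \<bar>real (loctime X (x + z) \<omega>) - h ^ nat \<bar>z\<bar> / (2 * q) * real r\<bar>
      < \<epsilon> * (h ^ nat \<bar>z\<bar> / (2 * q) * real r)) sequentially"
    using AE_eventually_neighbour_loctime_close[OF \<epsilon> c, of "2 * ell"] ell_pos by (auto simp: g_def)
  \<comment> \<open>Tuned so that \<open>L \<le> 2 * ell * r\<close> implies
    \<open>k2 * L powr (1 - g) \<le> \<kappa> * r powr (1 - g)\<close>.\<close>
  define k2 where "k2 = \<kappa> * (1 / (2 * ell)) powr (1 - g)"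
  have k2: "k2 > 0" using \<kappa> ell_pos by (simp add: k2_def)
  have ln_top: "filterlim (\<lambda>n. ln (real n)) at_top sequentially"
    by (rule filterlim_compose[OF ln_at_top filterlim_real_sequentially])
  have \<delta>_small: "eventually (\<lambda>n. \<bar>\<delta> n\<bar> * ln (real n) powr g < e) sequentially" if "e > 0" for e
  proof -
    have "eventually (\<lambda>n. \<bar>\<delta> n * ln (real n) powr g\<bar> < e) sequentially"
      using \<delta> that unfolding g_def[symmetric] tendsto_iff by (simp add: dist_real_def)
    then show ?thesis by (simp add: abs_mult)
  qed
  \<comment> \<open>The bound \<open>1 / 2\<close> on \<open>\<bar>\<delta> n\<bar>\<close> yields
    \<open>L \<le> 2 * ell * r\<close>, the reason for \<open>K = 2 * ell\<close>; the bound
    \<open>\<epsilon>\<close> yields \<open>\<rho> \<ge> 1 - \<epsilon>\<close>.\<close>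
  have \<epsilon>2: "min \<epsilon> (1 / 2) > 0" using \<epsilon> by simp
  have \<delta>_ev: "eventually (\<lambda>n. \<bar>\<delta> n\<bar> < min \<epsilon> (1 / 2) \<and> \<bar>\<delta> n\<bar> * ln (real n) \<le> k2 * ln (real n) powr (1 - g)) sequentially"
    using \<delta>_small[OF \<epsilon>2] \<delta>_small[OF k2] filterlim_at_top[THEN iffD1, OF ln_top, rule_format, of 1]
  proof eventually_elim
    case (elim n)
    have "1 \<le> ln (real n) powr g" using elim g by (simp add: ge_one_powr_ge_zero)
    then have "\<bar>\<delta> n\<bar> * 1 \<le> \<bar>\<delta> n\<bar> * ln (real n) powr g" by (intro mult_left_mono) auto
    then have "\<bar>\<delta> n\<bar> < min \<epsilon> (1 / 2)" using elim by linarith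
    have "ln (real n) powr g * ln (real n) powr (1 - g) = ln (real n)"
      using elim by (simp add: powr_add[symmetric])
    then have "\<bar>\<delta> n\<bar> * ln (real n) = \<bar>\<delta> n\<bar> * ln (real n) powr g * ln (real n) powr (1 - g)"
      by (simp only: mult.assoc)
    also have "\<dots> \<le> k2 * ln (real n) powr (1 - g)"
      using elim by (intro mult_right_mono) auto
    finally show ?case using \<open>\<bar>\<delta> n\<bar> < min \<epsilon> (1 / 2)\<close> by blast
  qed
  from close AE_eventually_loctime_neq[OF \<epsilon>(1)] AE_abs_walk_le show ?thesis
  proof eventually_elim
    case (elim \<omega>)
    from elim(1)[unfolded eventually_sequentially] obtain r1 where r1: "\<forall>r\<ge>r1. \<forall>x z.
        real_of_int \<bar>x\<bar> \<le> exp (ell * real r + \<kappa> * real r powr (1 - g)) \<longrightarrow> z \<noteq> 0 \<longrightarrow>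
        real_of_int \<bar>z\<bar> \<le> c * ln (2 * ell * real r) \<longrightarrow> loctime X x \<omega> = r \<longrightarrow>
        \<bar>real (loctime X (x + z) \<omega>) - h ^ nat \<bar>z\<bar> / (2 * q) * real r\<bar>
          < \<epsilon> * (h ^ nat \<bar>z\<bar> / (2 * q) * real r)"
      by (rule exE)
    from elim(2)[unfolded eventually_sequentially] obtain r2 where
      r2: "\<forall>r\<ge>r2. \<forall>x. real_of_int \<bar>x\<bar> \<le> exp (ell * real r / (1 + \<epsilon>)) \<longrightarrow> loctime X x \<omega> \<noteq> r"
      by (rule exE)
    define r0 where "r0 = max r1 r2"
    from \<delta>_ev filterlim_at_top[THEN iffD1, OF ln_top, rule_format, of "max 1 (2 * ell * (real r0 + 1))"]
      eventually_ge_at_top[of 1]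
    show ?case
    proof eventually_elim
      case (elim n)
      define L where "L = ln (real n)"
      have L: "L \<ge> 1" "L \<ge> 2 * ell * (real r0 + 1)" and n: "real n = exp L" using elim by (auto simp: L_def)
      show ?case
      proof (intro ballI allI impI)
        fix j z assume j: "j \<in> Bset X q \<delta> n \<omega>" and z: "real_of_int \<bar>z\<bar> \<le> c * ln (ln (real n))"
        define x where "x = walk X j \<omega>"
        define r where "r = loctime X x \<omega>"
        have "j \<le> n" and "(1 - \<delta> n) * (1 / ell) * L \<le> real r"
          using j by (auto simp: Bset_def r_def x_def lambda0 L_def)
        then have r_low: "(1 - \<delta> n) * L \<le> ell * real r" using ell_pos by (simp add: field_simps)
        have "(1 / 2) * L \<le> (1 - \<delta> n) * L" using elim L by (intro mult_right_mono) auto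
        with r_low have L_le: "L \<le> 2 * ell * real r" by simp
        with L have "2 * ell * (real r0 + 1) \<le> 2 * ell * real r" by linarith
        then have r_ge: "r \<ge> r1" "r \<ge> r2" "real r > 0" using ell_pos by (auto simp: r0_def)
        have x_le: "real_of_int \<bar>x\<bar> \<le> exp L"
          using \<open>\<forall>j. \<bar>walk X j \<omega>\<bar> \<le> int j\<close>[rule_format, of j] \<open>j \<le> n\<close> n unfolding x_def by linarith
        have r_up: "ell * real r < (1 + \<epsilon>) * L"
        proof -
          have "exp (ell * real r / (1 + \<epsilon>)) < real_of_int \<bar>x\<bar>"
            
            using r2[rule_format, OF r_ge(2), of x] unfolding r_def by (meson not_le)
          then have "exp (ell * real r / (1 + \<epsilon>)) < exp L" using x_le by linarith
          then show ?thesis using \<epsilon> by (simp add: field_simps)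
        qed
        define \<rho> where "\<rho> = ell * real r / L"
        have \<rho>: "1 - \<epsilon> \<le> \<rho>" "\<rho> \<le> 1 + \<epsilon>"
        proof -
          have "(1 - \<epsilon>) * L \<le> (1 - \<delta> n) * L" using elim L by (intro mult_right_mono) auto
          from order_trans[OF this r_low] show "1 - \<epsilon> \<le> \<rho>" using L by (simp add: \<rho>_def field_simps)
          show "\<rho> \<le> 1 + \<epsilon>" using r_up L by (simp add: \<rho>_def field_simps)
        qed
        show "\<bar>real (loctime X (walk X j \<omega> + z) \<omega>) / (mz q h z * lambda0 q * ln (real n)) - 1\<bar> \<le> 3 * \<epsilon>"
        proof (cases "z = 0")
          case True
          then have "real (loctime X (walk X j \<omega> + z) \<omega>) / (mz q h z * lambda0 q * ln (real n)) = \<rho>"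
            using ell_pos by (simp add: x_def[symmetric] r_def[symmetric] mz_def lambda0 L_def[symmetric] \<rho>_def)
          then show ?thesis using \<rho> \<epsilon> by (simp add: abs_le_iff)
        next
          case False
          define m where "m = h ^ nat \<bar>z\<bar> / (2 * q)"
          have mz: "mz q h z = m" using False by (simp add: mz_def m_def)
          have m: "m > 0" using h_pos q_pos by (simp add: m_def)
          \<comment> \<open>The rate of \<open>\<delta>\<close> is used here: it makes
            \<open>\<delta> n * L\<close> at most \<open>\<kappa> * r powr (1 - g)\<close>, so
            \<open>n = exp L\<close> and hence \<open>\<bar>x\<bar>\<close> stay inside the box of
            the neighbour estimate for this \<open>r\<close>.\<close>
          have "k2 * L powr (1 - g) = \<kappa> * (L / (2 * ell)) powr (1 - g)"
            using L ell_pos by (simp add: k2_def powr_mult[symmetric])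
          also have "\<dots> \<le> \<kappa> * real r powr (1 - g)"
            using \<kappa> g L ell_pos L_le by (intro mult_left_mono powr_mono2) (auto simp: field_simps)
          finally have "\<bar>\<delta> n\<bar> * L \<le> \<kappa> * real r powr (1 - g)" using elim by (simp add: L_def)
          moreover have "\<delta> n * L \<le> \<bar>\<delta> n\<bar> * L" using L by (intro mult_right_mono) auto
          ultimately have "L \<le> ell * real r + \<kappa> * real r powr (1 - g)"
            using r_low by (simp add: algebra_simps)
          then have "real_of_int \<bar>x\<bar> \<le> exp (ell * real r + \<kappa> * real r powr (1 - g))"
            using x_le by (meson exp_le_cancel_iff order_trans)
          moreover have "real_of_int \<bar>z\<bar> \<le> c * ln (2 * ell * real r)"
          proof -
            have "c * ln L \<le> c * ln (2 * ell * real r)" using c L L_le by (intro mult_left_mono ln_mono) auto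
            then show ?thesis using z by (simp add: L_def)
          qed
          ultimately have close: "\<bar>real (loctime X (x + z) \<omega>) - m * real r\<bar> < \<epsilon> * (m * real r)"

            using r1[rule_format, OF r_ge(1) _ False] unfolding m_def r_def by blast
          define a where "a = real (loctime X (x + z) \<omega>) / (m * real r)"
          have mr: "m * real r > 0" using m r_ge by simp
          have "real (loctime X (x + z) \<omega>) = a * (m * real r)" using m r_ge by (simp add: a_def)
          with close have "\<bar>(a - 1) * (m * real r)\<bar> < \<epsilon> * (m * real r)" by (simp add: algebra_simps)
          then have a: "\<bar>a - 1\<bar> < \<epsilon>" 
            unfolding abs_mult[of "a - 1"] abs_of_pos[OF mr] using mr by (rule mult_right_less_imp_less[OF _ less_imp_le])
          have "real (loctime X (walk X j \<omega> + z) \<omega>) / (mz q h z * lambda0 q * ln (real n)) = a * \<rho>"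
            using m r_ge L ell_pos
            by (simp add: mz x_def[symmetric] a_def \<rho>_def lambda0 L_def[symmetric] field_simps)
          moreover have "\<bar>a * \<rho> - 1\<bar> \<le> 3 * \<epsilon>"
          proof -
            have "a * \<rho> - 1 = (a - 1) * \<rho> + (\<rho> - 1)" by (simp add: algebra_simps)
            then have "\<bar>a * \<rho> - 1\<bar> \<le> \<bar>a - 1\<bar> * \<bar>\<rho>\<bar> + \<bar>\<rho> - 1\<bar>"
              by (metis abs_mult abs_triangle_ineq)
            also have "\<dots> \<le> \<epsilon> * 2 + \<epsilon>"
              using a \<rho> \<epsilon> by (intro add_mono mult_mono) (auto simp: abs_le_iff)
            finally show ?thesis by simp
          qed
          ultimately show ?thesis by simp
        qed
      qed
    qed
  qed
qed

end

section \<open>From eventual bounds to the almost sure limit of the maximum\<close>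

theorem theorem3p6:
  fixes M :: "'a measure" and X :: "nat \<Rightarrow> 'a \<Rightarrow> int"
    and p q h \<alpha> c :: real and \<delta> :: "nat \<Rightarrow> real"
  assumes "prob_space M"
    and "prob_space.indep_vars M (\<lambda>_. count_space UNIV) X UNIV"
    and "\<And>i. measure M {\<omega> \<in> space M. X i \<omega> = 1} = p"
    and "\<And>i. measure M {\<omega> \<in> space M. X i \<omega> = -1} = q"
    and "0 < q" and "q < p" and "p < 1" and "p + q = 1"
    and "h = q / p"
    and "\<alpha> = ln (1 / h)"
    and "c > 0" and "\<alpha> * c < 1"
    and "(\<lambda>n. \<delta> n * ln (real n) powr (\<alpha> * c)) \<longlonglongrightarrow> 0"
  shows "AE \<omega> in M. (\<lambda>n. Max (insert 0
            {\<bar>real (loctime X (walk X j \<omega> + z) \<omega>) / (mz q h z * lambda0 q * ln (real n)) - 1\<bar>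
             | j z. j \<in> Bset X q \<delta> n \<omega> \<and> real_of_int \<bar>z\<bar> \<le> c * ln (ln (real n))}))
          \<longlonglongrightarrow> 0"
proof -
  interpret W: biased_walk M X p q
    using assms by (intro biased_walk.intro biased_walk_axioms.intro) auto
  have h: "W.h = h" and \<alpha>: "- ln h = \<alpha>"
    using assms by (auto simp: W.h_def ln_div)
  define dev where "dev \<omega> n j z
    = \<bar>real (loctime X (walk X j \<omega> + z) \<omega>) / (mz q h z * lambda0 q * ln (real n)) - 1\<bar>" for \<omega> n j z
  define S where "S \<omega> n = {dev \<omega> n j z | j z. j \<in> Bset X q \<delta> n \<omega> \<and> real_of_int \<bar>z\<bar> \<le> c * ln (ln (real n))}" for \<omega> n
  \<comment> \<open>Finiteness gives \<open>Max\<close> its meaning. If the bound on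
    \<open>\<bar>z\<bar>\<close> is negative the set is empty, and only the inserted 0
    remains.\<close>
  have fin: "finite (S \<omega> n)" for \<omega> n
  proof (cases "c * ln (ln (real n)) \<ge> 0")
    case True
    have "S \<omega> n = (\<lambda>(j, z). dev \<omega> n j z) ` (Bset X q \<delta> n \<omega> \<times> {z. real_of_int \<bar>z\<bar> \<le> c * ln (ln (real n))})"
      by (auto simp: S_def)
    moreover have "finite (Bset X q \<delta> n \<omega>)" by (simp add: Bset_def)
    ultimately show ?thesis using card_int_ball_le(1)[OF True] by simp
  next
    case False
    then have "S \<omega> n = {}" by (auto simp: S_def)
    then show ?thesis by simp
  qed
  \<comment> \<open>The tolerances \<open>1 / (i + 1)\<close> are countably many, so one null set
    serves for all of them.\<close>
  have "AE \<omega> in M. \<forall>i::nat. eventually (\<lambda>n. \<forall>s\<in>S \<omega> n. s \<le> 3 * (1 / (real i + 1))) sequentially"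
    unfolding AE_all_countable
  proof
    fix i :: nat
    show "AE \<omega> in M. eventually (\<lambda>n. \<forall>s\<in>S \<omega> n. s \<le> 3 * (1 / (real i + 1))) sequentially"
      using W.AE_eventually_loctime_ratio_close[of "1 / (real i + 1)" c \<delta>, unfolded h \<alpha>] assms(11-13)
      by (auto simp: S_def dev_def elim!: AE_mp eventually_mono)
  qed
  then show ?thesis
  proof eventually_elim
    case (elim \<omega>)
    have "(\<lambda>n. Max (insert 0 (S \<omega> n))) \<longlonglongrightarrow> 0"
    proof (rule tendstoI)
      fix e :: real assume "e > 0"
      obtain i :: nat where "3 / e < real i" using reals_Archimedean2 by blast
      then have i: "3 * (1 / (real i + 1)) < e" using \<open>e > 0\<close> by (simp add: field_simps)
      from elim[rule_format, of i] show "eventually (\<lambda>n. dist (Max (insert 0 (S \<omega> n))) 0 < e) sequentially"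
      proof eventually_elim
        case (elim n)
        have "0 \<le> Max (insert 0 (S \<omega> n))" using fin by simp
        moreover have "Max (insert 0 (S \<omega> n)) < e"
          using fin elim i \<open>e > 0\<close> by (subst Max_less_iff) force+
        ultimately show ?case by simp
      qed
    qed
    then show ?case by (simp add: S_def dev_def)
  qed
qed

end
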